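(* Let $N$ be a prime number and $1\le d\le N$. There is a one-to-one correspondence between the unitary equivalence classes of harmonic frames for $\mathbb{C}^d$ with $N$ elements and the orbits of the action $\pi_2$ of $\mathbb{Z}_N^\times$ on $\mathbb{A}_N^d$, given by $$[\Phi_n]\longleftrightarrow\mathcal{O}_{[n]},\qquad n\in\tilde{\mathbb{Z}}_N^d,$$ i.e. the assignment $[\Phi_n]\mapsto\mathcal{O}_{[n]}$ is a well-defined bijection from the set of equivalence classes onto the set of orbits.
   Context: $\mathbb{Z}_N$ denotes the integers mod $N$, and $\mathbb{Z}_N^\times$ its multiplicative group of units. Let $\tilde{\mathbb{Z}}_N^d=\{n=(n_1,\ldots,n_d)\in\mathbb{Z}_N^d: n_i\ne n_j \text{ for all } i\neq j\}$. For $n\in\tilde{\mathbb{Z}}_N^d$, the DFT-FUNTF with generators $n$ is $\Phi_n=\{\phi_0,\ldots,\phi_{N-1}\}\subset\mathbb{C}^d$, where $\phi_m=\frac{1}{\sqrt d}(e^{2\pi i m n_1/N},\ldots,e^{2\pi i m n_d/N})$, considered as an unordered set. Harmonic frames (normalized to have unit norm vectors): for an abelian group $G$ of order $N$ with characters $\xi_1,\dots,\xi_N$, a subset $J\subseteq\{1,\ldots,N\}$ with $|J|=d$, and $U$ a unitary transformation of $\mathbb{C}^d$, the set $U\{\frac{1}{\sqrt d}(\xi_j(g))_{j\in J}:g\in G\}$ is a harmonic frame for $\mathbb{C}^d$ with $N$ elements. For $N$ prime these are exactly the sets $U\Phi_n$ with $U$ unitary and $n\in\tilde{\mathbb{Z}}_N^d$.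 Two harmonic frames $\Phi,\Psi$ are equivalent if $\Phi=V\Psi$ (equality of sets) for some unitary $V$ of $\mathbb{C}^d$; $[\Phi]$ denotes the equivalence class of $\Phi$. $\mathbb{A}_N^d$ is the quotient of $\tilde{\mathbb{Z}}_N^d$ by the relation identifying tuples that differ by a permutation of their coordinates; the class of $n$ is written $[n]=[n_1,\ldots,n_d]$ (so $\mathbb{A}_N^d$ can be identified with the set of $d$-element subsets of $\mathbb{Z}_N$). The action $\pi_2$ is $m\cdot[n]=[mn_1,\ldots,mn_d]$ for $m\in\mathbb{Z}_N^\times$, and $\mathcal{O}_{[n]}=\{m\cdot[n]: m\in\mathbb{Z}_N^\times\}$. *)

theory Defs
  imports
    "HOL-Analysis.Analysis"
    "HOL-Number_Theory.Residues"
    "HOL-Algebra.Group_Action"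
begin

text \<open>Throughout, the finite type \<open>'d\<close> indexes the coordinates, so that
  \<open>d = CARD('d)\<close> and \<open>complex ^ 'd\<close> is the space of complex \<open>d\<close>-vectors.\<close>

section \<open>Unitary transformations\<close>

definition unitary_matrix :: "complex^'d^'d \<Rightarrow> bool" where
  "unitary_matrix U \<longleftrightarrow>
     map_matrix cnj (transpose U) ** U = mat 1 \<and> U ** map_matrix cnj (transpose U) = mat 1"

section \<open>Harmonic frames\<close>

text \<open>Characters are taken to be \<^const>\<open>extensional\<close>, so that two of them are equal
  iff they agree on the group.\<close>

definition characters :: "('g, 'm) monoid_scheme \<Rightarrow> ('g \<Rightarrow> complex) set" where
  "characters G =
     hom G \<lparr>carrier = - {0}, mult = (*), one = 1\<rparr> \<inter> extensional (carrier G)"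

text \<open>The choice of \<open>d\<close> different characters, together with an assignment to coordinates, is an
  injection \<open>\<xi>\<close> of \<open>'d\<close> into the characters.\<close>

definition character_frame ::
    "('g, 'm) monoid_scheme \<Rightarrow> ('d::finite \<Rightarrow> 'g \<Rightarrow> complex) \<Rightarrow> (complex^'d) set" where
  "character_frame G \<xi> =
     (\<lambda>g. \<chi> j. complex_of_real (1 / sqrt (real CARD('d))) * \<xi> j g) ` carrier G"

text \<open>It suffices to let \<open>G\<close> range over groups on sets of natural numbers; see
  \<open>character_frame_harmonic\<close> below. A harmonic frame is an unordered set; it may have fewer
  than \<open>N\<close> members, since different group elements may give the same vector.\<close>

definition harmonic_frames :: "nat \<Rightarrow> (complex^'d::finite) set set" where
  "harmonic_frames N =
     {(*v) U ` character_frame G \<xi> | U (G :: nat monoid) \<xi>.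
        comm_group G \<and> order G = N \<and> inj \<xi> \<and> range \<xi> \<subseteq> characters G \<and> unitary_matrix U}"

lemma character_frame_harmonic:
  fixes G :: "'g monoid" and \<xi> :: "'d::finite \<Rightarrow> 'g \<Rightarrow> complex"
  assumes "comm_group G" "order G = N" "N > 0" "inj \<xi>" "range \<xi> \<subseteq> characters G" "unitary_matrix U"
  shows "(*v) U ` character_frame G \<xi> \<in> harmonic_frames N"
proof -
  interpret G: comm_group G by fact
  have fin: "finite (carrier G)"
    using assms(2,3) by (simp add: order_def card_ge_0_finite)
  then obtain h :: "'g \<Rightarrow> nat" where h: "bij_betw h (carrier G) {0..<N}"
    using ex_bij_betw_finite_nat[OF fin] assms(2) by (auto simp: order_def)
  define k where "k = inv_into (carrier G) h"
  have kh: "k (h x) = x" if "x \<in> carrier G" for x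
    using h that by (simp add: k_def bij_betw_def)
  have kc: "k a \<in> carrier G" if "a \<in> {0..<N}" for a
    using h that by (simp add: k_def bij_betw_def inv_into_into)
  have hk: "h (k a) = a" if "a \<in> {0..<N}" for a
    using h that by (simp add: k_def bij_betw_def f_inv_into_f)
  have hc: "h x \<in> {0..<N}" if "x \<in> carrier G" for x
    using h that by (auto simp: bij_betw_def)
  define H where "H = \<lparr>carrier = {0..<N}, mult = (\<lambda>a b. h (k a \<otimes>\<^bsub>G\<^esub> k b)), one = h \<one>\<^bsub>G\<^esub>\<rparr>"
  define \<eta> where "\<eta> = (\<lambda>j. restrict (\<xi> j \<circ> k) {0..<N})"
  have H: "comm_group H"
  proof (rule comm_groupI)
    fix x assume x: "x \<in> carrier H"
    have "h (inv\<^bsub>G\<^esub> (k x)) \<in> carrier H" "h (inv\<^bsub>G\<^esub> (k x)) \<otimes>\<^bsub>H\<^esub> x = \<one>\<^bsub>H\<^esub>"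
      using x hc kc by (auto simp: H_def kh simp del: atLeastLessThan_iff)
    then show "\<exists>y\<in>carrier H. y \<otimes>\<^bsub>H\<^esub> x = \<one>\<^bsub>H\<^esub>" by blast
  next
    fix x y z assume "x \<in> carrier H" "y \<in> carrier H" "z \<in> carrier H"
    then show "x \<otimes>\<^bsub>H\<^esub> y \<otimes>\<^bsub>H\<^esub> z = x \<otimes>\<^bsub>H\<^esub> (y \<otimes>\<^bsub>H\<^esub> z)"
      using kc by (simp add: H_def kh G.m_assoc del: atLeastLessThan_iff)
  next
    fix x y assume "x \<in> carrier H" "y \<in> carrier H"
    then show "x \<otimes>\<^bsub>H\<^esub> y = y \<otimes>\<^bsub>H\<^esub> x"
      using kc by (simp add: H_def G.m_comm del: atLeastLessThan_iff)
  qed (use hc kc hk in \<open>simp_all add: H_def kh del: atLeastLessThan_iff\<close>)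
  have ch: "\<eta> j \<in> characters H" for j
  proof -
    have *: "\<xi> j \<in> characters G" using assms(5) by auto
    then have "\<xi> j x \<noteq> 0" if "x \<in> carrier G" for x
      using that by (auto simp: characters_def hom_def)
    moreover from * have "\<xi> j (x \<otimes>\<^bsub>G\<^esub> y) = \<xi> j x * \<xi> j y"
      if "x \<in> carrier G" "y \<in> carrier G" for x y
      using that by (auto simp: characters_def hom_def)
    ultimately show ?thesis
      using kc hc kh
      by (auto simp: characters_def hom_def \<eta>_def H_def simp del: atLeastLessThan_iff)
  qed
  have eq: "\<eta> j (h x) = \<xi> j x" if "x \<in> carrier G" for x j
    using that hc[OF that] by (simp add: \<eta>_def kh)
  have inj: "inj \<eta>"
  proof (rule injI)
    fix i j assume e: "\<eta> i = \<eta> j"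
    have "\<xi> i x = \<xi> j x" for x
    proof (cases "x \<in> carrier G")
      case True
      then show ?thesis using eq e by metis
    next
      case False
      have "\<xi> i \<in> extensional (carrier G)" "\<xi> j \<in> extensional (carrier G)"
        using assms(5) by (auto simp: characters_def)
      then show ?thesis using False by (metis extensional_arb)
    qed
    then show "i = j" by (intro injD[OF assms(4)] ext)
  qed
  have "character_frame H \<eta> = character_frame G \<xi>"
  proof -
    have "carrier H = h ` carrier G" using h by (simp add: H_def bij_betw_def)
    then show ?thesis
      unfolding character_frame_def by (simp only: image_image) (rule image_cong, simp_all add: eq)
  qed
  moreover have "order H = N" by (simp add: order_def H_def)
  ultimately show ?thesis
    using H inj ch assms(6) unfolding harmonic_frames_def
    by (intro CollectI exI[of _ U] exI[of _ H] exI[of _ \<eta>]) auto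
qed

definition frame_equiv :: "nat \<Rightarrow> ((complex^'d::finite) set \<times> (complex^'d) set) set" where
  "frame_equiv N =
     {(\<Phi>, \<Psi>). \<Phi> \<in> harmonic_frames N \<and> \<Psi> \<in> harmonic_frames N \<and>
        (\<exists>V. unitary_matrix V \<and> \<Phi> = (*v) V ` \<Psi>)}"

definition frame_class :: "nat \<Rightarrow> (complex^'d::finite) set \<Rightarrow> (complex^'d) set set" where
  "frame_class N \<Phi> = frame_equiv N `` {\<Phi>}"

section \<open>DFT frames\<close>

text \<open>The integers mod \<open>N\<close> are represented by \<open>0, \<dots>, N - 1\<close>.\<close>

definition distinct_tuples :: "nat \<Rightarrow> ('d \<Rightarrow> int) set" where
  "distinct_tuples N = {n. range n \<subseteq> carrier (residue_ring (int N)) \<and> inj n}"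

definition dft_frame :: "nat \<Rightarrow> ('d::finite \<Rightarrow> int) \<Rightarrow> (complex^'d) set" where
  "dft_frame N n =
     (\<lambda>m. \<chi> j. complex_of_real (1 / sqrt (real CARD('d))) *
          exp (2 * of_real pi * \<i> * of_nat m * of_int (n j) / of_nat N)) ` {0..<N}"

lemma dft_frame_harmonic:
  fixes n :: "'d::finite \<Rightarrow> int"
  assumes "N > 0" "n \<in> distinct_tuples N"
  shows "dft_frame N n \<in> harmonic_frames N"
proof -
  define G :: "nat monoid" where
    "G = \<lparr>carrier = {0..<N}, mult = (\<lambda>a b. (a + b) mod N), one = 0\<rparr>"
  define e where
    "e = (\<lambda>a b. exp (2 * of_real pi * \<i> * of_nat a * of_int b / of_nat N) :: complex)"
  define \<xi> where "\<xi> = (\<lambda>j. restrict (\<lambda>m. e m (n j)) {0..<N})"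
  have nr: "0 \<le> n j" "n j < int N" for j
    using assms(2) by (force simp: distinct_tuples_def residue_ring_def image_subset_iff)+
  have e_add: "e (a + b) c = e a c * e b c" for a b c
    by (simp add: e_def flip: exp_add) (simp add: field_simps add_divide_distrib)
  have e_N: "e (N * q) c = 1" for q c
  proof -
    have "e (N * q) c = exp (2 * of_int (int q * c) * of_real pi * \<i>)"
      using assms(1) by (simp add: e_def field_simps)
    also have "\<dots> = 1" using exp_integer_2pi[of "of_int (int q * c)"] by (simp add: ac_simps)
    finally show ?thesis .
  qed
  have e_mod: "e (a mod N) c = e a c" for a c
  proof -
    have "e a c = e (N * (a div N) + a mod N) c" by simp
    also have "\<dots> = e (a mod N) c" by (simp only: e_add e_N mult_1)
    finally show ?thesis by simp
  qed
  have "comm_group G"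
  proof (rule comm_groupI)
    fix x assume x: "x \<in> carrier G"
    show "\<exists>y\<in>carrier G. y \<otimes>\<^bsub>G\<^esub> x = \<one>\<^bsub>G\<^esub>"
      by (rule bexI[of _ "(N - x) mod N"])
        (use x in \<open>auto simp: G_def mod_add_left_eq\<close>)
  qed (use assms(1) in \<open>auto simp: G_def mod_simps ac_simps\<close>)
  moreover have "order G = N" by (simp add: order_def G_def)
  moreover have "range \<xi> \<subseteq> characters G"
    using assms(1)
    by (auto simp: characters_def hom_def \<xi>_def G_def e_mod e_add) (simp add: e_def)
  moreover have "inj \<xi>"
  proof (rule injI)
    fix i j assume eq: "\<xi> i = \<xi> j"
    have "n i = n j"
    proof (cases "N = 1")
      case True
      then show ?thesis using nr[of i] nr[of j] by simp
    next
      case False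
      then have "e 1 (n i) = e 1 (n j)"
        using fun_cong[OF eq, of 1] assms(1) by (simp add: \<xi>_def)
      then have "exp (2 * of_real pi * \<i> * of_nat (nat (n i)) / of_nat N) =
                 exp (2 * of_real pi * \<i> * of_nat (nat (n j)) / of_nat N)"
        using nr by (simp add: e_def)
      then have "nat (n i) mod N = nat (n j) mod N"
        using complex_root_unity_eq[of N "nat (n i)" "nat (n j)"] assms(1) by (simp add: cong_def)
      then show ?thesis using nr[of i] nr[of j] by (simp add: nat_less_iff)
    qed
    then show "i = j" using assms(2) by (auto simp: distinct_tuples_def dest: injD)
  qed
  moreover have "unitary_matrix (mat 1 :: complex^'d^'d)"
  proof -
    have "map_matrix cnj (mat 1 :: complex^'d^'d) = mat 1"
      by (simp add: vec_eq_iff mat_def map_matrix_def)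
    then show ?thesis by (simp add: unitary_matrix_def)
  qed
  moreover have "dft_frame N n = (*v) (mat 1) ` character_frame G \<xi>"
    unfolding dft_frame_def character_frame_def image_image
    by (rule image_cong) (auto simp: G_def \<xi>_def e_def)
  ultimately show ?thesis
    using character_frame_harmonic[of G N \<xi> "mat 1"] assms(1) by simp
qed

section \<open>The action on unordered tuples\<close>

definition perm_equiv :: "nat \<Rightarrow> (('d \<Rightarrow> int) \<times> ('d \<Rightarrow> int)) set" where
  "perm_equiv N =
     {(n, n'). n \<in> distinct_tuples N \<and> n' \<in> distinct_tuples N \<and> (\<exists>\<sigma>. bij \<sigma> \<and> n' = n \<circ> \<sigma>)}"

definition unordered_tuples :: "nat \<Rightarrow> ('d \<Rightarrow> int) set set" where
  "unordered_tuples N = distinct_tuples N // perm_equiv N"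

definition tuple_class :: "nat \<Rightarrow> ('d \<Rightarrow> int) \<Rightarrow> ('d \<Rightarrow> int) set" where
  "tuple_class N n = perm_equiv N `` {n}"

lemma tuple_class_eq: "n \<in> distinct_tuples N \<Longrightarrow> tuple_class N n = {n \<circ> \<sigma> | \<sigma>. bij \<sigma>}"
  by (auto simp: tuple_class_def perm_equiv_def distinct_tuples_def bij_def intro: inj_compose)

text \<open>The action multiplies all representatives of a class; by \<open>pi2_tuple_class\<close> below the
  result is the class of \<open>(m n\<^sub>1, \<dots>, m n\<^sub>d)\<close>. The restriction makes this an action in the sense of
  \<^const>\<open>group_action\<close>.\<close>

definition pi2 :: "nat \<Rightarrow> int \<Rightarrow> ('d \<Rightarrow> int) set \<Rightarrow> ('d \<Rightarrow> int) set" where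
  "pi2 N m = (\<lambda>c\<in>unordered_tuples N. (\<lambda>n i. m \<otimes>\<^bsub>residue_ring (int N)\<^esub> n i) ` c)"

abbreviation unit_group :: "nat \<Rightarrow> int monoid" where
  "unit_group N \<equiv> units_of (residue_ring (int N))"

lemma pi2_tuple_class:
  fixes n :: "'d \<Rightarrow> int"
  assumes "N > 1" "m \<in> carrier (unit_group N)" "n \<in> distinct_tuples N"
  shows "pi2 N m (tuple_class N n) = tuple_class N (\<lambda>i. m \<otimes>\<^bsub>residue_ring (int N)\<^esub> n i)"
proof -
  interpret residues "int N" "residue_ring (int N)"
    using assms(1) by unfold_locales auto
  let ?R = "residue_ring (int N)"
  have m: "m \<in> Units ?R" using assms(2) by (simp add: units_of_def)
  have n: "n i \<in> carrier ?R" "inj n" for i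
    using assms(3) by (auto simp: distinct_tuples_def)
  have "(\<lambda>i. m \<otimes>\<^bsub>?R\<^esub> n i) \<in> distinct_tuples N"
    using m n by (auto simp: distinct_tuples_def inj_def)
  moreover have "tuple_class N n \<in> unordered_tuples N"
    using assms(3) by (auto simp: tuple_class_def unordered_tuples_def quotient_def)
  ultimately show ?thesis
    using assms(3) by (auto simp: pi2_def tuple_class_eq comp_def image_def)
qed

end

(* The vectors of a DFT frame have the inner products (1/d) sum_j w^((k - l) n_j), with w a
   primitive N-th root of unity. A unitary equivalence of two such frames therefore gives a relation
   sum_j w^(n'_j) = sum_j w^(m n_j), and since 1 + x + ... + x^(N-1) is irreducible for N prime, the
   generator sets satisfy {n'_j} = m {n_j}. Conversely, scaling the generators by a unit only
   reorders the frame, and permuting them applies a permutation matrix. Finally, a group of prime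
   order is cyclic and its characters are given by N-th roots of unity, so every harmonic frame is
   equivalent to a DFT frame. *)

theory Submission
  imports Defs
begin

hide_const (open) up_ring.coeff up_ring.monom Module.smult

section \<open>Integer relations between roots of unity of prime order\<close>

text \<open>Let \<open>k\<close> be the first index where \<open>p\<close> does not divide the
  coefficient of \<open>A\<close>. Modulo \<open>p\<close>, the coefficient of \<open>A * B\<close>
  at \<open>k\<close> is \<open>coeff A k * coeff B 0\<close>, which is nonzero. Hence the degree of
  the product is at most \<open>k\<close>, so at most the degree of \<open>A\<close>.\<close>

lemma eisenstein_factor:
  fixes A B :: "int poly"
  assumes p: "prime p" and low: "\<And>i. i < degree (A * B) \<Longrightarrow> p dvd coeff (A * B) i"
    and lead: "\<not> p dvd lead_coeff (A * B)" and B0: "\<not> p dvd coeff B 0"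
  shows "degree B = 0"
proof -
  have nz: "A \<noteq> 0" "B \<noteq> 0" using lead by auto
  have leadA: "\<not> p dvd lead_coeff A" using lead by (auto simp: lead_coeff_mult)
  define k where "k = (LEAST i. \<not> p dvd coeff A i)"
  have k: "\<not> p dvd coeff A k" unfolding k_def using leadA by (rule LeastI)
  have kle: "k \<le> degree A" unfolding k_def using leadA by (rule Least_le)
  have less: "p dvd coeff A i" if "i < k" for i
    using not_less_Least[of i "\<lambda>i. \<not> p dvd coeff A i"] that by (auto simp: k_def)
  have "coeff (A * B) k = (\<Sum>i<k. coeff A i * coeff B (k - i)) + coeff A k * coeff B 0"
    by (simp add: coeff_mult flip: lessThan_Suc_atMost)
  moreover have "p dvd (\<Sum>i<k. coeff A i * coeff B (k - i))"
    by (intro dvd_sum dvd_mult2 less) auto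
  moreover have "\<not> p dvd coeff A k * coeff B 0"
    using p k B0 by (simp add: prime_dvd_mult_iff)
  ultimately have "\<not> p dvd coeff (A * B) k" by (simp add: dvd_add_right_iff)
  then have "degree (A * B) \<le> k" using low not_less by blast
  then show ?thesis using kle nz by (simp add: degree_mult_eq)
qed

text \<open>Since \<open>p\<close> squared does not divide the constant coefficient of the product,
  \<open>p\<close> cannot divide those of both factors; a factor where it does not is constant by
  \<open>eisenstein_factor\<close>.\<close>

lemma eisenstein:
  fixes A B :: "int poly"
  assumes p: "prime p" and low: "\<And>i. i < degree (A * B) \<Longrightarrow> p dvd coeff (A * B) i"
    and lead: "\<not> p dvd lead_coeff (A * B)" and const: "\<not> p\<^sup>2 dvd coeff (A * B) 0"
  shows "degree A = 0 \<or> degree B = 0"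
proof (cases "p dvd coeff B 0")
  case True
  then have "\<not> p dvd coeff A 0"
    using const by (auto simp: coeff_mult_0 power2_eq_square intro: mult_dvd_mono)
  then show ?thesis
    using eisenstein_factor[of p B A] p low lead by (simp add: mult.commute)
next
  case False
  have "degree B = 0"
    by (rule eisenstein_factor[OF p]) (erule low, fact lead, fact False)
  then show ?thesis ..
qed

section \<open>Degrees of integer polynomials vanishing at a complex number\<close>

abbreviation of_int_poly :: "int poly \<Rightarrow> complex poly" where
  "of_int_poly \<equiv> map_poly of_int"

lemma of_int_poly_add: "of_int_poly (p + q) = of_int_poly p + of_int_poly q"
  by (rule poly_eqI) (simp add: coeff_map_poly)

lemma of_int_poly_mult: "of_int_poly (p * q) = of_int_poly p * of_int_poly q"
  by (rule poly_eqI) (simp add: coeff_map_poly coeff_mult)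

lemma of_int_poly_smult: "of_int_poly (smult a p) = smult (of_int a) (of_int_poly p)"
  by (rule poly_eqI) (simp add: coeff_map_poly)

lemma of_int_poly_sum: "of_int_poly (\<Sum>i\<in>I. f i) = (\<Sum>i\<in>I. of_int_poly (f i))"
  by (rule poly_eqI) (simp add: coeff_map_poly coeff_sum)

lemma of_int_poly_power: "of_int_poly (p ^ n) = of_int_poly p ^ n"
  by (induction n) (simp_all add: of_int_poly_mult map_poly_1')

text \<open>An integer polynomial of least degree vanishing at a root of \<open>f\<close> divides \<open>f\<close>, up to a
  constant, by pseudo-division, and Gauss' lemma turns this into a factorization over the
  integers.\<close>

lemma eisenstein_minimal_degree:
  fixes f g :: "int poly" and z :: complex
  assumes p: "prime p" and low: "\<And>i. i < degree f \<Longrightarrow> p dvd coeff f i"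
    and lead: "lead_coeff f = 1" and const: "\<not> p\<^sup>2 dvd coeff f 0"
    and fz: "poly (of_int_poly f) z = 0" and gz: "poly (of_int_poly g) z = 0" and g0: "g \<noteq> 0"
  shows "degree f \<le> degree g"
proof -
  obtain h where h: "h \<noteq> 0" "poly (of_int_poly h) z = 0"
    and hmin: "\<And>q. q \<noteq> 0 \<Longrightarrow> poly (of_int_poly q) z = 0 \<Longrightarrow> degree h \<le> degree q"
    using ex_has_least_nat[of "\<lambda>q. q \<noteq> 0 \<and> poly (of_int_poly q) z = 0" g degree] gz g0 by blast
  define u where "u = primitive_part h"
  have hu: "h = smult (content h) u" by (simp add: u_def)
  have u: "u \<noteq> 0" "content u = 1" "degree u = degree h" using h(1) by (auto simp: u_def)
  have "of_int (content h) * poly (of_int_poly u) z = 0"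
    using h(2) by (subst (asm) hu) (simp only: of_int_poly_smult poly_smult)
  then have uz: "poly (of_int_poly u) z = 0" using h(1) by simp
  obtain a q where aq: "a \<noteq> 0" "smult a f = u * q + pseudo_mod f u"
    using pseudo_mod(1)[OF u(1), of f] by blast
  \<comment> \<open>The remainder also vanishes at \<open>z\<close>, so a nonzero remainder would
    contradict the minimality of the degree of \<open>u\<close>.\<close>
  have "poly (of_int_poly (pseudo_mod f u)) z = 0"
  proof -
    have "poly (of_int_poly (smult a f)) z = poly (of_int_poly (u * q + pseudo_mod f u)) z"
      using aq(2) by simp
    then show ?thesis using fz uz by (simp add: of_int_poly_smult of_int_poly_add of_int_poly_mult)
  qed
  then have "pseudo_mod f u = 0"
    using hmin[of "pseudo_mod f u"] pseudo_mod(2)[OF u(1), of f] u(3) by fastforce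
  then have af: "smult a f = u * q" using aq(2) by simp
  \<comment> \<open>Both \<open>f\<close>, being monic, and \<open>u\<close> are primitive. As
    contents multiply, the content of \<open>q\<close> is the absolute value of \<open>a\<close>,
    and the factor \<open>a\<close> can be cancelled.\<close>
  have "content f dvd 1" using content_dvd_coeff[of f "degree f"] lead by simp
  then have cf: "content f = 1" using normalize_content[of f] is_unit_normalize by metis
  have "content q = \<bar>a\<bar>"
    using arg_cong[OF af, of content] u(2) cf by (simp add: content_mult)
  then have qa: "q = smult \<bar>a\<bar> (primitive_part q)"
    using content_times_primitive_part[of q] by simp
  \<comment> \<open>The factor \<open>sgn a\<close> restores the sign that the content of
    \<open>q\<close> has lost.\<close>
  define v where "v = smult (sgn a) (primitive_part q)"
  have "smult a f = smult a (u * v)"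
    by (subst af, subst qa) (simp add: v_def abs_sgn)
  then have f: "f = u * v" using aq(1) by (metis smult_cancel)
  have "degree u = 0 \<or> degree v = 0"
    using eisenstein[of p u v] p low lead const not_prime_unit[of p] by (auto simp: f[symmetric])
  \<comment> \<open>A nonzero constant has no root, so the constant factor must be
    \<open>v\<close>.\<close>
  then have "degree u = degree f"
  proof
    assume "degree u = 0"
    then obtain c where "u = [:c:]" by (rule degree_eq_zeroE)
    then show ?thesis using uz u(1) by (simp add: map_poly_pCons)
  next
    assume "degree v = 0"
    moreover have "v \<noteq> 0" using f lead by auto
    ultimately show ?thesis using f u(1) by (simp add: degree_mult_eq)
  qed
  then show ?thesis using hmin[OF g0 gz] u(3) by simp
qed

text \<open>With \<open>z = w - 1\<close>, the quotient \<open>((1 + z)^p - 1) / z\<close> is an Eisenstein polynomial of degree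
  \<open>p - 1\<close> in \<open>z\<close>.\<close>

lemma root_of_unity_minimal_degree:
  fixes g :: "int poly" and w :: complex
  assumes p: "prime p" and w: "w ^ p = 1" "w \<noteq> 1"
    and g: "poly (of_int_poly g) (w - 1) = 0" "g \<noteq> 0"
  shows "p - 1 \<le> degree g"
proof -
  define z where "z = w - 1"
  \<comment> \<open>The binomial theorem gives these coefficients; the leading one is
    \<open>p choose p = 1\<close> and the constant one is \<open>p choose 1 = p\<close>.\<close>
  define f :: "int poly" where "f = (\<Sum>k<p. monom (int (p choose Suc k)) k)"
  have p1: "p > 1" using p by (rule prime_gt_1_nat)
  have cf: "coeff f i = (if i < p then int (p choose Suc i) else 0)" for i
    by (simp add: f_def coeff_sum)
  have deg: "degree f = p - 1"
    by (rule antisym, rule degree_le) (use p1 in \<open>auto simp: cf intro!: le_degree\<close>)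
  \<comment> \<open>Multiplication by \<open>z\<close>, which is nonzero, shifts the sum to the
    expansion of \<open>(1 + z) ^ p\<close> without its constant term.\<close>
  have "z * poly (of_int_poly f) z = (\<Sum>k<p. of_nat (p choose Suc k) * z ^ Suc k)"
    by (simp add: f_def of_int_poly_sum poly_sum map_poly_monom poly_monom sum_distrib_left ac_simps)
  also have "\<dots> = (\<Sum>k\<le>p. of_nat (p choose k) * z ^ k) - 1"
    by (simp add: sum.lessThan_Suc_shift flip: lessThan_Suc_atMost del: sum.lessThan_Suc)
  also have "(\<Sum>k\<le>p. of_nat (p choose k) * z ^ k) = (z + 1) ^ p"
    by (simp add: binomial_ring)
  finally have "poly (of_int_poly f) z = 0" using w by (simp add: z_def)
  moreover have "\<not> (int p)\<^sup>2 dvd int p"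
    using p1 by (auto simp: power2_eq_square)
  moreover have "int p dvd int (p choose Suc i)" if "i < p - 1" for i
    using that p dvd_choose_prime[of "Suc i" p] by simp
  ultimately show ?thesis
    using eisenstein_minimal_degree[of "int p" f z g] p p1 g by (simp add: deg cf z_def)
qed

text \<open>Subtracting \<open>c (p - 1)\<close> times the relation 1 + w + ... + w^(p-1) = 0
  removes the top power. What remains has degree at most \<open>p - 2\<close> in \<open>w\<close>,
  so its coefficients vanish by \<open>root_of_unity_minimal_degree\<close>.\<close>

lemma prime_root_of_unity_relation:
  fixes c :: "nat \<Rightarrow> int" and w :: complex
  assumes p: "prime p" and w: "w ^ p = 1" "w \<noteq> 1"
    and rel: "(\<Sum>k<p. of_int (c k) * w ^ k) = 0" and i: "i < p"
  shows "c i = c (p - 1)"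
proof -
  have p1: "p > 1" using p by (rule prime_gt_1_nat)
  define d where "d = (\<lambda>k. c k - c (p - 1))"
  \<comment> \<open>Powers of \<open>1 + x\<close> are used because the degree bound is about values
    at \<open>w - 1\<close>.\<close>
  define g where "g = (\<Sum>k<p - 1. smult (d k) ([:1, 1:] ^ k))"
  have geom: "(\<Sum>k<p. w ^ k) = 0"
    using w by (simp add: sum_gp_strict)
  have "poly (of_int_poly g) (w - 1) = (\<Sum>k<p - 1. of_int (d k) * w ^ k)"
    by (simp add: g_def of_int_poly_sum of_int_poly_smult of_int_poly_power poly_sum map_poly_pCons)
  \<comment> \<open>The term at \<open>p - 1\<close> may be added because
    \<open>d (p - 1) = 0\<close>.\<close>
  also have "\<dots> = (\<Sum>k<p. of_int (d k) * w ^ k)"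
    using p1 by (cases p) (simp_all add: d_def)
  also have "\<dots> = (\<Sum>k<p. of_int (c k) * w ^ k) - of_int (c (p - 1)) * (\<Sum>k<p. w ^ k)"
    by (simp add: d_def left_diff_distrib sum_subtractf sum_distrib_left)
  also have "\<dots> = 0" using rel geom by simp
  finally have gz: "poly (of_int_poly g) (w - 1) = 0" .
  have "degree g \<le> p - 2"
    unfolding g_def
  proof (intro degree_sum_le)
    fix k assume "k \<in> {..<p - 1}"
    then show "degree (smult (d k) ([:1, 1:] ^ k)) \<le> p - 2"
      using degree_smult_le[of "d k" "[:1, 1:] ^ k"] by (simp add: degree_power_eq)
  qed auto
  then have "g = 0"
    using root_of_unity_minimal_degree[OF p w gz] p1 by fastforce
  \<comment> \<open>Replacing \<open>x\<close> by \<open>x - 1\<close> in \<open>g\<close> undoes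
    the shift and exposes the coefficients \<open>d k\<close>.\<close>
  have "(\<Sum>k<p - 1. monom (d k) k) = 0"
  proof (rule poly_eq_poly_eq_iff[THEN iffD1], rule ext)
    fix x
    have "poly (\<Sum>k<p - 1. monom (d k) k) x = poly g (x - 1)"
      by (simp add: g_def poly_sum poly_monom)
    then show "poly (\<Sum>k<p - 1. monom (d k) k) x = poly 0 x" using \<open>g = 0\<close> by simp
  qed
  then have "coeff (\<Sum>k<p - 1. monom (d k) k) i = 0" by simp
  then have "i < p - 1 \<Longrightarrow> d i = 0" by (simp add: coeff_sum)
  then show ?thesis using i by (cases "i = p - 1") (auto simp: d_def)
qed

section \<open>Roots of unity with integer exponents\<close>

definition unity_root :: "nat \<Rightarrow> int \<Rightarrow> complex" where
  "unity_root N k = exp (2 * of_real pi * \<i> * of_int k / of_nat N)"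

lemma unity_root_add: "unity_root N (k + l) = unity_root N k * unity_root N l"
  by (simp add: unity_root_def algebra_simps add_divide_distrib flip: exp_add)

lemma unity_root_0 [simp]: "unity_root N 0 = 1"
  by (simp add: unity_root_def)

lemma unity_root_of_nat: "unity_root N (int m * k) = unity_root N k ^ m"
  by (simp add: unity_root_def ac_simps flip: exp_of_nat_mult)

lemma cnj_unity_root: "cnj (unity_root N k) = unity_root N (- k)"
  by (simp add: unity_root_def exp_cnj)

lemma unity_root_eq_1_iff:
  assumes "N > 0"
  shows "unity_root N k = 1 \<longleftrightarrow> int N dvd k"
proof -
  have "unity_root N k = 1 \<longleftrightarrow> (\<exists>n::int. real_of_int k / real N = of_int n)"
    using assms by (auto simp: unity_root_def exp_eq_1 field_simps)
  also have "\<dots> \<longleftrightarrow> (\<exists>n::int. real_of_int k = real_of_int (int N * n))"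
    using assms by (simp add: field_simps)
  also have "\<dots> \<longleftrightarrow> int N dvd k"
    by (simp only: of_int_eq_iff dvd_def)
  finally show ?thesis .
qed

lemma unity_root_eq_1_imp_0:
  assumes "unity_root N k = 1" "0 \<le> k" "k < int N"
  shows "k = 0"
proof -
  have "int N dvd k" using assms by (simp flip: unity_root_eq_1_iff)
  then show ?thesis using assms(2,3) zdvd_not_zless[of k "int N"] by fastforce
qed

lemma unity_root_eq_iff:
  assumes "N > 0"
  shows "unity_root N k = unity_root N l \<longleftrightarrow> k mod int N = l mod int N"
proof -
  have "unity_root N k = unity_root N (k - l) * unity_root N l"
    by (simp flip: unity_root_add)
  then have "unity_root N k = unity_root N l \<longleftrightarrow> unity_root N (k - l) = 1"
    by (simp add: unity_root_def)
  then show ?thesis using assms by (simp add: unity_root_eq_1_iff mod_eq_dvd_iff)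
qed

lemma unity_root_mod [simp]: "unity_root N (k mod int N) = unity_root N k"
  by (cases "N = 0") (simp_all add: unity_root_eq_iff)

text \<open>The difference \<open>c\<close> of the two indicator functions gives a vanishing
  relation, so it is constant, and its total \<open>card S - card T\<close> is 0. Equal
  cardinalities exclude the pair of the empty set and all residues, whose sums are both 0.\<close>

lemma sum_unity_root_eqD:
  assumes N: "prime N" and S: "S \<subseteq> {0..<int N}" and T: "T \<subseteq> {0..<int N}"
    and card: "card S = card T" and eq: "(\<Sum>k\<in>S. unity_root N k) = (\<Sum>k\<in>T. unity_root N k)"
  shows "S = T"
proof -
  have N1: "N > 1" using N by (rule prime_gt_1_nat)
  define w where "w = unity_root N 1"
  define c :: "nat \<Rightarrow> int" where "c = (\<lambda>k. of_bool (int k \<in> S) - of_bool (int k \<in> T))"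
  have pw: "unity_root N (int k) = w ^ k" for k
    using unity_root_of_nat[of N k 1] by (simp add: w_def)
  have wN: "w ^ N = 1" "w \<noteq> 1"
    using N1 pw[of N] unity_root_eq_1_iff[of N "int N"] by (simp_all add: w_def unity_root_eq_1_iff)
  \<comment> \<open>Used for the roots of unity and, with the constant function 1, for the
    cardinalities.\<close>
  have conv: "(\<Sum>k\<in>A. h k) = (\<Sum>k<N. of_bool (int k \<in> A) * h (int k))"
    if "A \<subseteq> {0..<int N}" for A and h :: "int \<Rightarrow> 'a::comm_ring_1"
  proof -
    have "(\<Sum>k\<in>A. h k) = (\<Sum>k\<in>int ` {..<N}. of_bool (k \<in> A) * h k)"
      by (rule sum.mono_neutral_cong_left)
        (use that in \<open>auto simp: lessThan_atLeast0 image_int_atLeastLessThan\<close>)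
    also have "\<dots> = (\<Sum>k<N. of_bool (int k \<in> A) * h (int k))"
      by (simp only: sum.reindex[OF inj_on_subset[OF inj_of_nat subset_UNIV]] comp_def)
    finally show ?thesis .
  qed
  have "(\<Sum>k<N. of_int (c k) * w ^ k) = 0"
    using eq by (simp add: conv[OF S] conv[OF T] c_def algebra_simps sum_subtractf pw)
  then have c: "c i = c (N - 1)" if "i < N" for i
    using prime_root_of_unity_relation[OF N wN] that by blast
  have "(\<Sum>k<N. c k) = int (card S) - int (card T)"
    using conv[OF S, of "\<lambda>_. 1 :: int"] conv[OF T, of "\<lambda>_. 1 :: int"]
    by (simp add: c_def sum_subtractf)
  moreover have "(\<Sum>k<N. c k) = int N * c (N - 1)"
    by (subst sum.cong[OF refl c]) simp_all
  ultimately have "c (N - 1) = 0" using card N1 by simp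
  then have c0: "c i = 0" if "i < N" for i using c[OF that] by simp
  have "k \<in> S \<longleftrightarrow> k \<in> T" if "k \<in> {0..<int N}" for k
    using c0[of "nat k"] that by (auto simp: c_def of_bool_def nat_less_iff split: if_splits)
  then show ?thesis using S T by blast
qed

section \<open>Unitary equivalence\<close>

abbreviation adjoint_matrix :: "complex^'d^'d \<Rightarrow> complex^'d^'d" where
  "adjoint_matrix U \<equiv> map_matrix cnj (transpose U)"

lemma adjoint_matrix_adjoint [simp]: "adjoint_matrix (adjoint_matrix U) = U"
  by (simp add: vec_eq_iff map_matrix_def transpose_def)

lemma adjoint_matrix_mult: "adjoint_matrix (U ** V) = adjoint_matrix V ** adjoint_matrix U"
  by (simp add: vec_eq_iff map_matrix_def transpose_def matrix_matrix_mult_def mult.commute)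

lemma unitary_matrix_mat_1: "unitary_matrix (mat 1)"
proof -
  have "adjoint_matrix (mat 1 :: complex^'d^'d) = mat 1"
    by (simp add: transpose_mat) (simp add: vec_eq_iff map_matrix_def mat_def)
  then show ?thesis by (simp add: unitary_matrix_def)
qed

lemma unitary_matrix_adjoint: "unitary_matrix U \<Longrightarrow> unitary_matrix (adjoint_matrix U)"
  by (simp add: unitary_matrix_def)

lemma unitary_matrix_mult:
  assumes "unitary_matrix U" "unitary_matrix V"
  shows "unitary_matrix (U ** V)"
proof -
  have "adjoint_matrix V ** adjoint_matrix U ** (U ** V) =
      adjoint_matrix V ** (adjoint_matrix U ** U) ** V"
    by (simp only: matrix_mul_assoc)
  moreover have "U ** V ** (adjoint_matrix V ** adjoint_matrix U) =
      U ** (V ** adjoint_matrix V) ** adjoint_matrix U"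
    by (simp only: matrix_mul_assoc)
  ultimately show ?thesis
    using assms by (simp add: unitary_matrix_def adjoint_matrix_mult)
qed

lemma equiv_frame_equiv: "equiv (harmonic_frames N :: (complex^'d::finite) set set) (frame_equiv N)"
proof (rule equivI)
  show "(frame_equiv N :: (_ \<times> (complex^'d) set) set) \<subseteq> harmonic_frames N \<times> harmonic_frames N"
    by (auto simp: frame_equiv_def)
  show "refl_on (harmonic_frames N :: (complex^'d) set set) (frame_equiv N)"
    by (auto simp: refl_on_def frame_equiv_def intro!: exI[of _ "mat 1"] unitary_matrix_mat_1)
  show "sym (frame_equiv N :: (_ \<times> (complex^'d) set) set)"
  proof (rule symI)
    fix \<Phi> \<Psi> :: "(complex^'d) set"
    assume "(\<Phi>, \<Psi>) \<in> frame_equiv N"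
    then obtain V where V: "unitary_matrix V" "\<Phi> = (*v) V ` \<Psi>"
      and *: "\<Phi> \<in> harmonic_frames N" "\<Psi> \<in> harmonic_frames N"
      by (auto simp: frame_equiv_def)
    have "\<Psi> = (*v) (adjoint_matrix V) ` \<Phi>"
      using V by (simp add: image_image matrix_vector_mul_assoc unitary_matrix_def)
    then show "(\<Psi>, \<Phi>) \<in> frame_equiv N"
      using * unitary_matrix_adjoint[OF V(1)] by (auto simp: frame_equiv_def)
  qed
  show "trans (frame_equiv N :: (_ \<times> (complex^'d) set) set)"
  proof (rule transI)
    fix \<Phi> \<Psi> \<Omega> :: "(complex^'d) set"
    assume "(\<Phi>, \<Psi>) \<in> frame_equiv N" "(\<Psi>, \<Omega>) \<in> frame_equiv N"
    then obtain U V where UV: "unitary_matrix U" "unitary_matrix V"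
      "\<Phi> = (*v) U ` \<Psi>" "\<Psi> = (*v) V ` \<Omega>"
      and *: "\<Phi> \<in> harmonic_frames N" "\<Omega> \<in> harmonic_frames N"
      by (auto simp: frame_equiv_def)
    then have "\<Phi> = (*v) (U ** V) ` \<Omega>"
      by (simp add: image_image matrix_vector_mul_assoc)
    then show "(\<Phi>, \<Omega>) \<in> frame_equiv N"
      using * unitary_matrix_mult[OF UV(1,2)] by (auto simp: frame_equiv_def)
  qed
qed

text \<open>The sums are Hermitian inner products. By \<open>*\<close> the columns of
  \<open>V\<close> are orthonormal, so the expanded double sum over \<open>a\<close> and
  \<open>b\<close> collapses to its diagonal.\<close>

lemma unitary_matrix_inner:
  fixes V :: "complex^'d^'d::finite"
  assumes "unitary_matrix V"
  shows "(\<Sum>i\<in>UNIV. (V *v x) $ i * cnj ((V *v y) $ i)) = (\<Sum>i\<in>UNIV. x $ i * cnj (y $ i))"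
proof -
  have *: "(\<Sum>i\<in>UNIV. cnj (V $ i $ b) * V $ i $ a) = of_bool (a = b)" for a b
  proof -
    have "(adjoint_matrix V ** V) $ b $ a = (mat 1 :: complex^'d^'d) $ b $ a"
      using assms by (simp add: unitary_matrix_def)
    then show ?thesis
      by (simp add: matrix_matrix_mult_def map_matrix_def transpose_def mat_def)
  qed
  have "(\<Sum>i\<in>UNIV. (V *v x) $ i * cnj ((V *v y) $ i)) =
      (\<Sum>i\<in>UNIV. \<Sum>a\<in>UNIV. \<Sum>b\<in>UNIV. x $ a * cnj (y $ b) * (cnj (V $ i $ b) * V $ i $ a))"
    by (simp add: matrix_vector_mult_def sum_product ac_simps)
  also have "\<dots> = (\<Sum>a\<in>UNIV. \<Sum>b\<in>UNIV. \<Sum>i\<in>UNIV. x $ a * cnj (y $ b) * (cnj (V $ i $ b) * V $ i $ a))"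
    by (rule trans[OF sum.swap], rule sum.cong[OF refl], rule sum.swap)
  also have "\<dots> = (\<Sum>a\<in>UNIV. \<Sum>b\<in>UNIV. x $ a * cnj (y $ b) * of_bool (a = b))"
    by (intro sum.cong refl) (simp only: * sum_distrib_left[symmetric])
  also have "\<dots> = (\<Sum>a\<in>UNIV. x $ a * cnj (y $ a))"
    by (simp add: of_bool_def if_distrib cong: if_cong)
  finally show ?thesis .
qed

text \<open>Fact \<open>1\<close> says that the columns are orthonormal, fact \<open>2\<close> that
  the rows are.\<close>

lemma unitary_matrix_permutation:
  fixes \<sigma> :: "'d::finite \<Rightarrow> 'd"
  assumes "bij \<sigma>"
  shows "unitary_matrix (\<chi> i j. of_bool (j = \<sigma> i))"
proof -
  have 1: "(\<Sum>k\<in>UNIV. of_bool (a = \<sigma> k) * of_bool (b = \<sigma> k) :: complex) = of_bool (a = b)" for a b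
  proof -
    have "(\<Sum>k\<in>UNIV. of_bool (a = \<sigma> k) * of_bool (b = \<sigma> k) :: complex) =
        (\<Sum>k\<in>UNIV. of_bool (a = k) * of_bool (b = k))"
      using assms by (rule sum.reindex_bij_betw)
    also have "\<dots> = (\<Sum>k\<in>UNIV. if a = k then of_bool (a = b) else 0)"
      by (rule sum.cong) auto
    finally show ?thesis by simp
  qed
  have 2: "(\<Sum>k\<in>UNIV. of_bool (k = \<sigma> a) * of_bool (k = \<sigma> b) :: complex) = of_bool (a = b)" for a b
  proof -
    have "(\<Sum>k\<in>UNIV. of_bool (k = \<sigma> a) * of_bool (k = \<sigma> b) :: complex) =
        (\<Sum>k\<in>UNIV. if k = \<sigma> a then of_bool (a = b) else 0)"
      by (rule sum.cong) (use assms in \<open>auto simp: bij_def inj_eq\<close>)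
    then show ?thesis by simp
  qed
  have cnj: "cnj (of_bool P) = of_bool P" for P by simp
  have mat: "(mat 1 :: complex^'d^'d) = (\<chi> i j. of_bool (i = j))"
    by (simp add: mat_def vec_eq_iff)
  show ?thesis
    by (simp only: unitary_matrix_def vec_eq_iff matrix_matrix_mult_def map_matrix_def
        transpose_def mat vec_lambda_beta cnj 1 2 simp_thms)
qed

section \<open>DFT frames up to unitary equivalence\<close>

text \<open>The index is an arbitrary integer, so that indices can be subtracted and multiplied
  without reduction mod \<open>N\<close>.\<close>

definition dft_vector :: "nat \<Rightarrow> ('d::finite \<Rightarrow> int) \<Rightarrow> int \<Rightarrow> complex^'d" where
  "dft_vector N n m = (\<chi> j. complex_of_real (1 / sqrt (real CARD('d))) * unity_root N (m * n j))"

text \<open>The vectors are periodic in the index with period \<open>N\<close>, so arbitrary integer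
  indices add nothing to the frame.\<close>

lemma dft_frame_eq:
  assumes "N > 0"
  shows "dft_frame N n = range (dft_vector N n)"
proof -
  have "dft_frame N n = (\<lambda>m. dft_vector N n (int m)) ` {0..<N}"
    by (simp add: dft_frame_def dft_vector_def unity_root_def mult.assoc)
  moreover have "dft_vector N n m \<in> (\<lambda>m. dft_vector N n (int m)) ` {0..<N}" for m
  proof (rule image_eqI)
    have "unity_root N (m mod int N * k) = unity_root N (m * k)" for k
      using unity_root_mod[of N "m mod int N * k"] unity_root_mod[of N "m * k"]
      by (simp add: mod_mult_left_eq)
    then show "dft_vector N n m = dft_vector N n (int (nat (m mod int N)))"
      using assms by (simp add: dft_vector_def)
    show "nat (m mod int N) \<in> {0..<N}"
      using assms by (simp add: nat_less_iff)
  qed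
  ultimately show ?thesis by auto
qed

lemma dft_vector_inner:
  fixes n :: "'d::finite \<Rightarrow> int"
  shows "(\<Sum>i\<in>UNIV. dft_vector N n k $ i * cnj (dft_vector N n l $ i)) =
     (\<Sum>i\<in>UNIV. unity_root N ((k - l) * n i)) / of_nat CARD('d)"
proof -
  have "complex_of_real (sqrt (real CARD('d))) * complex_of_real (sqrt (real CARD('d))) =
      of_nat CARD('d)"
    by (simp flip: of_real_mult)
  moreover have "unity_root N ((k - l) * x) = unity_root N (k * x) * unity_root N (- (l * x))" for x
    by (simp add: left_diff_distrib flip: unity_root_add)
  ultimately show ?thesis
    by (simp add: dft_vector_def cnj_unity_root sum_divide_distrib)
qed

section \<open>Generator tuples, their ranges and scaling by units\<close>

lemma distinct_tuplesD:
  assumes "n \<in> distinct_tuples N"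
  shows "inj n" "0 \<le> n i" "n i < int N"
  using assms by (force simp: distinct_tuples_def residue_ring_def image_subset_iff)+

text \<open>The permutation is \<open>g\<close> followed by the inverse of \<open>f\<close>. This
  translates between reordered tuples and equal generator sets.\<close>

lemma range_eq_iff_permutation:
  assumes "inj f" "inj g"
  shows "range f = range g \<longleftrightarrow> (\<exists>\<sigma>. bij \<sigma> \<and> g = f \<circ> \<sigma>)"
proof
  assume eq: "range f = range g"
  have "bij_betw g UNIV (range f)" using assms eq by (simp add: bij_betw_def)
  then have "bij (inv_into UNIV f \<circ> g)"
    using inj_imp_bij_betw_inv[OF assms(1)] by (rule bij_betw_trans)
  moreover have "g = f \<circ> (inv_into UNIV f \<circ> g)"
    using eq by (auto simp: fun_eq_iff f_inv_into_f)
  ultimately show "\<exists>\<sigma>. bij \<sigma> \<and> g = f \<circ> \<sigma>" by blast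
next
  assume "\<exists>\<sigma>. bij \<sigma> \<and> g = f \<circ> \<sigma>"
  then show "range f = range g" by (metis bij_def fun.set_map)
qed

context residues_prime
begin

lemma in_Units_iff: "m \<in> Units R \<longleftrightarrow> m \<in> {0..<int p} \<and> m \<noteq> 0"
  using m_gt_one by (auto simp: field_Units res_carrier_eq res_zero_eq)

lemma mult_distinct_tuples:
  assumes "m \<in> Units R" "n \<in> distinct_tuples p"
  shows "(\<lambda>i. m \<otimes> n i) \<in> distinct_tuples p"
proof -
  have "n i \<in> carrier R" for i
    using assms(2) by (auto simp: distinct_tuples_def R_m_def)
  then show ?thesis
    using assms by (auto simp: distinct_tuples_def inj_def R_m_def[symmetric])
qed

text \<open>Scaling the generators by \<open>m\<close> turns the vector of index \<open>l\<close>
  into that of index \<open>l * m\<close>, and multiplication by a unit permutes the indices mod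
  \<open>p\<close>.\<close>

lemma dft_frame_mult:
  assumes "m \<in> Units R"
  shows "dft_frame p (\<lambda>i. m \<otimes> n i) = dft_frame p n"
proof -
  obtain k where k: "k \<in> carrier R" "k \<otimes> m = \<one>"
    using assms by (auto simp: Units_def)
  have *: "dft_vector p (\<lambda>i. m \<otimes> n i) l = dft_vector p n (l * m)" for l
  proof -
    have "unity_root p (l * ((m * x) mod int p)) = unity_root p (l * m * x)" for x
      using unity_root_mod[of p "l * ((m * x) mod int p)"] unity_root_mod[of p "l * (m * x)"]
      by (simp add: mod_mult_right_eq ac_simps)
    then show ?thesis by (simp add: dft_vector_def res_mult_eq)
  qed
  \<comment> \<open>With \<open>k\<close> inverse to \<open>m\<close>, the index
    \<open>l * k\<close> of the scaled frame yields the vector of index \<open>l\<close>.\<close>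
  have "dft_vector p n l = dft_vector p n (l * k * m)" for l
  proof -
    have "(l * k * m * x) mod int p = (l * x) mod int p" for x
    proof -
      have "(k * m) mod int p = 1" using k(2) by (simp add: res_mult_eq res_one_eq)
      then have "((l * x) * (k * m)) mod int p = (l * x) mod int p"
        by (metis mod_mult_right_eq mult.right_neutral)
      then show ?thesis by (simp add: ac_simps)
    qed
    then have "unity_root p (l * k * m * x) = unity_root p (l * x)" for x
      by (metis unity_root_mod)
    then show ?thesis by (simp add: dft_vector_def)
  qed
  then have "range (dft_vector p n) \<subseteq> range (\<lambda>l. dft_vector p n (l * m))" by blast
  then show ?thesis using p_prime by (auto simp: dft_frame_eq prime_gt_0_nat *)
qed

text \<open>A unitary map carries two neighbouring vectors of one frame to \<open>\<phi>\<^sub>a\<close> and \<open>\<phi>\<^sub>b\<close> of the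
  other, so equality of the inner products is a relation between \<open>p\<close>-th roots of unity, which
  identifies the generators up to the factor \<open>a - b\<close>.\<close>

lemma dft_frame_equiv_imp_range:
  fixes n n' :: "'d::finite \<Rightarrow> int"
  assumes n: "n \<in> distinct_tuples p" and n': "n' \<in> distinct_tuples p"
    and V: "unitary_matrix V" and eq: "dft_frame p n = (*v) V ` dft_frame p n'"
  shows "\<exists>m\<in>Units R. range n' = (\<otimes>) m ` range n"
proof -
  have p0: "p > 0" using p_prime by (rule prime_gt_0_nat)
  have range: "range (dft_vector p n) = (*v) V ` range (dft_vector p n')"
    using eq p0 by (simp add: dft_frame_eq)
  then have "V *v dft_vector p n' k \<in> range (dft_vector p n)" for k by blast
  then have "\<exists>a. V *v dft_vector p n' k = dft_vector p n a" for k by auto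
  then obtain a b where ab: "V *v dft_vector p n' 1 = dft_vector p n a"
    "V *v dft_vector p n' 0 = dft_vector p n b" by metis
  define m where "m = (a - b) mod int p"
  have "(\<Sum>i\<in>UNIV. unity_root p ((1 - 0) * n' i)) / complex_of_nat CARD('d) =
      (\<Sum>i\<in>UNIV. unity_root p ((a - b) * n i)) / complex_of_nat CARD('d)"
    unfolding dft_vector_inner[symmetric] ab[symmetric]
    by (rule unitary_matrix_inner[OF V, symmetric])
  then have sums: "(\<Sum>i\<in>UNIV. unity_root p (n' i)) = (\<Sum>i\<in>UNIV. unity_root p ((a - b) * n i))"
    by simp
  have mm: "unity_root p (m \<otimes> x) = unity_root p ((a - b) * x)" for x
    using unity_root_mod[of p "(a - b) * x"] by (simp add: m_def res_mult_eq mod_mult_left_eq)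
  show ?thesis
  proof (cases "m = 0")
    case False
    then have m: "m \<in> Units R" using p0 by (simp add: in_Units_iff m_def)
    let ?mn = "\<lambda>i. m \<otimes> n i"
    have mn: "?mn \<in> distinct_tuples p" using mult_distinct_tuples[OF m n] .
    \<comment> \<open>Injectivity turns sums over coordinates into sums over generator sets, which
      have equal size.\<close>
    have "(\<Sum>k\<in>range n'. unity_root p k) = (\<Sum>k\<in>range ?mn. unity_root p k)"
      using sums distinct_tuplesD(1)[OF n'] distinct_tuplesD(1)[OF mn]
      by (simp add: sum.reindex mm)
    then have "range n' = range ?mn"
      using distinct_tuplesD[OF n'] distinct_tuplesD[OF mn]
      by (intro sum_unity_root_eqD[OF p_prime]) (auto simp: card_image)
    then show ?thesis using m by (auto simp: image_image)
  next
    \<comment> \<open>Here \<open>a\<close> and \<open>b\<close> agree mod \<open>p\<close>, so the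
      vectors of index 1 and 0 for \<open>n'\<close> coincide and \<open>n'\<close> is zero. Then
      both frames are singletons and \<open>n\<close> is zero too, so the unit 1 works. By
      injectivity this can occur only in dimension 1.\<close>
    case True
    have "dft_vector p n a = dft_vector p n b"
    proof -
      have *: "unity_root p ((a - b) * x) = 1" for x
        using True p0 by (simp add: unity_root_eq_1_iff m_def mod_eq_0_iff_dvd)
      have "unity_root p (a * x) = unity_root p (b * x)" for x
      proof -
        have "a * x = (a - b) * x + b * x" by (simp add: left_diff_distrib)
        then show ?thesis by (simp only: unity_root_add * mult_1)
      qed
      then show ?thesis by (simp add: dft_vector_def)
    qed
    then have "V *v dft_vector p n' 1 = V *v dft_vector p n' 0" using ab by simp
    then have "dft_vector p n' 1 = dft_vector p n' 0"
      using V by (metis matrix_vector_mul_assoc matrix_vector_mul_lid unitary_matrix_def)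
    then have "unity_root p (n' i) = 1" for i
      by (simp add: dft_vector_def vec_eq_iff)
    then have n'0: "n' i = 0" for i
      using unity_root_eq_1_imp_0 distinct_tuplesD(2,3)[OF n', of i] by blast
    then have "range (dft_vector p n') = {dft_vector p n' 0}"
      by (auto simp: dft_vector_def)
    then have "range (dft_vector p n) = {V *v dft_vector p n' 0}" using range by simp
    then have "dft_vector p n 1 = dft_vector p n 0" by (metis rangeI singletonD)
    then have "unity_root p (n i) = 1" for i
      by (simp add: dft_vector_def vec_eq_iff)
    then have n0: "n i = 0" for i
      using unity_root_eq_1_imp_0 distinct_tuplesD(2,3)[OF n, of i] by blast
    have "\<one> \<in> Units R" "range n' = (\<otimes>) \<one> ` range n"
      using n0 n'0 by (auto simp: image_def res_mult_eq)
    then show ?thesis by blast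
  qed
qed

lemma dft_frame_equiv_iff:
  fixes n n' :: "'d::finite \<Rightarrow> int"
  assumes n: "n \<in> distinct_tuples p" and n': "n' \<in> distinct_tuples p"
  shows "(dft_frame p n, dft_frame p n') \<in> frame_equiv p \<longleftrightarrow>
    (\<exists>m\<in>Units R. range n' = (\<otimes>) m ` range n)"
proof
  assume "(dft_frame p n, dft_frame p n') \<in> frame_equiv p"
  then show "\<exists>m\<in>Units R. range n' = (\<otimes>) m ` range n"
    using dft_frame_equiv_imp_range[OF n n'] by (auto simp: frame_equiv_def)
next
  assume "\<exists>m\<in>Units R. range n' = (\<otimes>) m ` range n"
  then obtain m where m: "m \<in> Units R" "range n' = range (\<lambda>i. m \<otimes> n i)"
    by (auto simp: image_image)
  have p0: "p > 0" using p_prime by (rule prime_gt_0_nat)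
  obtain \<sigma> where \<sigma>: "bij \<sigma>" "(\<lambda>i. m \<otimes> n i) = n' \<circ> \<sigma>"
    using m range_eq_iff_permutation[of n' "\<lambda>i. m \<otimes> n i"] distinct_tuplesD(1)[OF n']
      distinct_tuplesD(1)[OF mult_distinct_tuples[OF m(1) n]] by blast
  \<comment> \<open>This matrix permutes coordinates by \<open>\<sigma>\<close> and carries the
    vectors for \<open>n'\<close> to those for \<open>n' \<circ> \<sigma>\<close>.\<close>
  define P :: "complex^'d^'d" where "P = (\<chi> i j. of_bool (j = \<sigma> i))"
  have P: "P *v x = (\<chi> i. x $ \<sigma> i)" for x
    by (simp add: P_def vec_eq_iff matrix_vector_mult_def of_bool_def if_distrib if_distribR
        cong: if_cong)
  have "dft_frame p n = dft_frame p (n' \<circ> \<sigma>)"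
    using dft_frame_mult[OF m(1), of n] \<sigma>(2) by simp
  also have "\<dots> = (*v) P ` dft_frame p n'"
    using p0 by (simp add: dft_frame_eq image_image P) (simp add: dft_vector_def)
  finally show "(dft_frame p n, dft_frame p n') \<in> frame_equiv p"
    using dft_frame_harmonic[OF p0 n] dft_frame_harmonic[OF p0 n']
      unitary_matrix_permutation[OF \<sigma>(1), folded P_def]
    unfolding frame_equiv_def by blast
qed

text \<open>Allows classes of tuples to be treated as subsets of the residues.\<close>

lemma tuple_class_eq_iff:
  assumes "n \<in> distinct_tuples p" "n' \<in> distinct_tuples p"
  shows "tuple_class p n = tuple_class p n' \<longleftrightarrow> range n = range n'"
proof
  assume "tuple_class p n = tuple_class p n'"
  moreover have "n' \<in> tuple_class p n'"
    using assms by (auto simp: tuple_class_eq intro!: exI[of _ id])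
  ultimately have "n' \<in> tuple_class p n" by simp
  then have "\<exists>\<sigma>. bij \<sigma> \<and> n' = n \<circ> \<sigma>" using assms(1) by (auto simp: tuple_class_eq)
  then show "range n = range n'"
    by (subst range_eq_iff_permutation) (use assms distinct_tuplesD(1) in auto)
next
  assume "range n = range n'"
  then obtain \<sigma> where \<sigma>: "bij \<sigma>" "n' = n \<circ> \<sigma>"
    using range_eq_iff_permutation[of n n'] assms[THEN distinct_tuplesD(1)] by blast
  have "\<exists>\<tau>'. n \<circ> \<tau> = n' \<circ> \<tau>' \<and> bij \<tau>'" if "bij \<tau>" for \<tau>
    using that \<sigma> by (intro exI[of _ "inv_into UNIV \<sigma> \<circ> \<tau>"])
      (auto simp: fun_eq_iff bij_is_surj surj_f_inv_f intro: bij_comp bij_imp_bij_inv)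
  moreover have "\<exists>\<tau>'. n' \<circ> \<tau> = n \<circ> \<tau>' \<and> bij \<tau>'" if "bij \<tau>" for \<tau>
    using that \<sigma> by (intro exI[of _ "\<sigma> \<circ> \<tau>"]) (auto intro: bij_comp)
  ultimately show "tuple_class p n = tuple_class p n'"
    using assms by (auto simp: tuple_class_eq)
qed

lemma orbit_tuple_class:
  assumes "n \<in> distinct_tuples p"
  shows "orbit (unit_group p) (pi2 p) (tuple_class p n) =
    (\<lambda>m. tuple_class p (\<lambda>i. m \<otimes> n i)) ` Units R"
  using assms pi2_tuple_class[of p _ n] m_gt_one
  by (auto simp: orbit_def units_of_def R_m_def image_def)

text \<open>The condition on the right is that of \<open>dft_frame_equiv_iff\<close>; it links
  orbits to classes of frames.\<close>

lemma orbit_eq_iff: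
  fixes n n' :: "'d::finite \<Rightarrow> int"
  assumes n: "n \<in> distinct_tuples p" and n': "n' \<in> distinct_tuples p"
  shows "orbit (unit_group p) (pi2 p) (tuple_class p n) =
      orbit (unit_group p) (pi2 p) (tuple_class p n') \<longleftrightarrow>
    (\<exists>m\<in>Units R. range n' = (\<otimes>) m ` range n)"
proof -
  have nR: "n i \<in> carrier R" "n' i \<in> carrier R" for i
    using n n' by (auto simp: distinct_tuples_def R_m_def)
  show ?thesis
  proof
    assume "orbit (unit_group p) (pi2 p) (tuple_class p n) =
      orbit (unit_group p) (pi2 p) (tuple_class p n')"
    moreover have "tuple_class p n' \<in> orbit (unit_group p) (pi2 p) (tuple_class p n')"
      unfolding orbit_tuple_class[OF n']
      by (rule image_eqI[of _ _ \<one>]) (use nR in auto)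
    ultimately have "tuple_class p n' \<in> orbit (unit_group p) (pi2 p) (tuple_class p n)" by simp
    then obtain m where m: "m \<in> Units R" "tuple_class p n' = tuple_class p (\<lambda>i. m \<otimes> n i)"
      unfolding orbit_tuple_class[OF n] by blast
    then have "range n' = range (\<lambda>i. m \<otimes> n i)"
      using tuple_class_eq_iff[OF n' mult_distinct_tuples[OF m(1) n]] by simp
    then show "\<exists>m\<in>Units R. range n' = (\<otimes>) m ` range n"
      using m(1) by (auto simp: image_image)
  next
    assume "\<exists>m\<in>Units R. range n' = (\<otimes>) m ` range n"
    then obtain m where m: "m \<in> Units R" "range n' = (\<otimes>) m ` range n" by blast
    \<comment> \<open>As sets, \<open>k\<close> times the generators \<open>n'\<close> are
      \<open>k \<otimes> m\<close> times the generators \<open>n\<close>.\<close>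
    have eq: "tuple_class p (\<lambda>i. k \<otimes> n' i) = tuple_class p (\<lambda>i. (k \<otimes> m) \<otimes> n i)"
      if k: "k \<in> Units R" for k
    proof -
      have "range (\<lambda>i. k \<otimes> n' i) = (\<otimes>) k ` range n'"
        by (simp add: image_image)
      also have "\<dots> = range (\<lambda>i. (k \<otimes> m) \<otimes> n i)"
        unfolding m(2) using Units_closed[OF k] Units_closed[OF m(1)] nR
        by (simp add: image_image m_assoc)
      finally show ?thesis
        using k m(1) n n' by (simp add: tuple_class_eq_iff mult_distinct_tuples)
    qed
    \<comment> \<open>Multiplication by \<open>m\<close> permutes the units, so the orbit of
      \<open>n\<close> can be indexed by the products \<open>k \<otimes> m\<close>.\<close>
    have units: "Units R = (\<lambda>k. k \<otimes> m) ` Units R"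
    proof (intro equalityI subsetI)
      fix x assume x: "x \<in> Units R"
      show "x \<in> (\<lambda>k. k \<otimes> m) ` Units R"
        by (rule image_eqI[of _ _ "x \<otimes> inv m"]) (use x m(1) in \<open>simp_all add: m_assoc Units_closed\<close>)
    qed (use m(1) in auto)
    have "(\<lambda>k. tuple_class p (\<lambda>i. k \<otimes> n i)) ` Units R =
        (\<lambda>k. tuple_class p (\<lambda>i. (k \<otimes> m) \<otimes> n i)) ` Units R"
      by (subst units) (simp only: image_image)
    then show "orbit (unit_group p) (pi2 p) (tuple_class p n) =
      orbit (unit_group p) (pi2 p) (tuple_class p n')"
      using eq by (simp add: orbit_tuple_class n n')
  qed
qed

end

section \<open>Groups of prime order\<close>

text \<open>The order of an element other than the identity divides the prime group order and is not
  1, so its powers fill the group.\<close>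

lemma (in group) prime_order_carrier:
  assumes "prime (order G)"
  obtains g where "g \<in> carrier G" "carrier G = (\<lambda>m. g [^] m) ` {0..<order G}"
proof -
  have fin: "finite (carrier G)"
    using assms by (metis order_gt_0_iff_finite prime_gt_0_nat)
  have "carrier G \<noteq> {\<one>}"
    using assms by (auto simp: order_def)
  then obtain g where g: "g \<in> carrier G" "g \<noteq> \<one>" by blast
  then have "ord g \<noteq> 1" using ord_eq_1 by blast
  then have "ord g = order G"
    using ord_dvd_group_order[OF g(1)] assms by (metis prime_nat_iff)
  moreover have "inj_on (\<lambda>m. g [^] m) {0..ord g - 1}" using ord_inj[OF g(1)] .
  moreover have "{0..order G - 1} = {0..<order G}"
    using assms prime_gt_0_nat[of "order G"] by auto
  ultimately have "card ((\<lambda>m. g [^] m) ` {0..<order G}) = card (carrier G)"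
    by (simp add: card_image order_def)
  then have "(\<lambda>m. g [^] m) ` {0..<order G} = carrier G"
    using g(1) fin by (intro card_subset_eq) auto
  then show ?thesis using that g(1) by blast
qed

text \<open>A character is determined by its value at a generator \<open>g\<close> of the group, an
  \<open>N\<close>-th root of unity. The exponents of these values form the tuple
  \<open>n\<close>.\<close>

lemma harmonic_frame_equiv_dft:
  fixes \<Phi> :: "(complex^'d::finite) set"
  assumes N: "prime N" and \<Phi>: "\<Phi> \<in> harmonic_frames N"
  shows "\<exists>n\<in>distinct_tuples N. (\<Phi>, dft_frame N n) \<in> frame_equiv N"
proof -
  have N0: "N > 0" using N by (rule prime_gt_0_nat)
  obtain U :: "complex^'d^'d" and G :: "nat monoid" and \<xi> where G: "comm_group G" "order G = N"
    and \<xi>: "inj \<xi>" "range \<xi> \<subseteq> characters G" and U: "unitary_matrix U"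
    and \<Phi>_eq: "\<Phi> = (*v) U ` character_frame G \<xi>"
    using \<Phi> unfolding harmonic_frames_def by blast
  interpret G: comm_group G by fact
  obtain g where g: "g \<in> carrier G" "carrier G = (\<lambda>m. g [^]\<^bsub>G\<^esub> (m::nat)) ` {0..<N}"
    using G.prime_order_carrier G(2) N by metis
  have ch: "\<xi> j \<in> characters G" for j using \<xi>(2) by auto
  have mult: "\<xi> j (x \<otimes>\<^bsub>G\<^esub> y) = \<xi> j x * \<xi> j y" if "x \<in> carrier G" "y \<in> carrier G" for j x y
    using ch[of j] that by (auto simp: characters_def hom_def)
  have nz: "\<xi> j x \<noteq> 0" if "x \<in> carrier G" for j x
    using ch[of j] that by (auto simp: characters_def hom_def)
  have one: "\<xi> j \<one>\<^bsub>G\<^esub> = 1" for j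
    using mult[of "\<one>\<^bsub>G\<^esub>" "\<one>\<^bsub>G\<^esub>" j] nz[of "\<one>\<^bsub>G\<^esub>" j] by simp
  have pow: "\<xi> j (g [^]\<^bsub>G\<^esub> (m::nat)) = \<xi> j g ^ m" for j m
    by (induction m) (use g(1) in \<open>simp_all add: one mult\<close>)
  have "\<exists>k. 0 \<le> k \<and> k < int N \<and> \<xi> j g = unity_root N k" for j
  proof -
    have "\<xi> j g ^ N = 1"
      using pow[of j N] G.pow_order_eq_1[OF g(1)] by (simp add: G(2) one)
    then have "\<xi> j g \<in> {exp (2 * of_real pi * \<i> * of_nat k / of_nat N) | k. k < N}"
      using complex_roots_unity[of N] N0 by auto
    then obtain k where "k < N" "\<xi> j g = exp (2 * of_real pi * \<i> * of_nat k / of_nat N)" by blast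
    then show ?thesis by (intro exI[of _ "int k"]) (simp add: unity_root_def)
  qed
  then obtain n where n: "\<And>j. 0 \<le> n j" "\<And>j. n j < int N" "\<And>j. \<xi> j g = unity_root N (n j)"
    by metis
  have "inj n"
  proof (rule injI)
    fix i j assume "n i = n j"
    then have "\<xi> i g = \<xi> j g" by (simp add: n(3))
    \<comment> \<open>Characters that agree at \<open>g\<close> agree on all its powers; outside the
      carrier they agree because they are extensional.\<close>
    then have "\<xi> i x = \<xi> j x" if "x \<in> carrier G" for x
      using that g(2) by (auto simp: pow)
    then have "\<xi> i = \<xi> j"
      using ch[of i] ch[of j] by (intro extensionalityI[of _ "carrier G"]) (auto simp: characters_def)
    then show "i = j" using \<xi>(1) by (simp add: inj_eq)
  qed
  then have nd: "n \<in> distinct_tuples N"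
    using n(1,2) N0 by (auto simp: distinct_tuples_def residue_ring_def)
  \<comment> \<open>The \<open>m\<close>-th power of \<open>g\<close> contributes the DFT vector of
    index \<open>m\<close>, so \<open>U\<close> itself is the required unitary map.\<close>
  have "character_frame G \<xi> = dft_frame N n"
    unfolding character_frame_def dft_frame_def g(2) image_image pow
    by (rule image_cong) (simp_all add: n(3) ac_simps unity_root_def flip: exp_of_nat_mult)
  then have "(\<Phi>, dft_frame N n) \<in> frame_equiv N"
    using \<Phi> \<Phi>_eq U dft_frame_harmonic[OF N0 nd] by (auto simp: frame_equiv_def)
  then show ?thesis using nd by blast
qed

text \<open>The bijection picks a preimage under \<open>F\<close> and applies \<open>H\<close>. One
  direction of the hypothesis makes this independent of the choice, the other makes it
  injective.\<close>

lemma ex_bij_betw_images: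
  assumes "\<And>x y. x \<in> A \<Longrightarrow> y \<in> A \<Longrightarrow> F x = F y \<longleftrightarrow> H x = H y"
  shows "\<exists>f. (\<forall>x\<in>A. f (F x) = H x) \<and> bij_betw f (F ` A) (H ` A)"
proof -
  have inv: "inv_into A F (F x) \<in> A" "F (inv_into A F (F x)) = F x" if "x \<in> A" for x
    using that by (auto intro: inv_into_into f_inv_into_f)
  then have f: "(H \<circ> inv_into A F) (F x) = H x" if "x \<in> A" for x
    using assms that by (metis comp_apply)
  moreover have "bij_betw (H \<circ> inv_into A F) (F ` A) (H ` A)"
    by (rule bij_betw_imageI)
      (use assms f in \<open>auto intro!: inj_onI simp: image_image simp del: comp_apply\<close>)
  ultimately show ?thesis by blast
qed

theorem proposition3p2:
  fixes N :: nat
  assumes "prime N" and "CARD('d::finite) \<le> N"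
  shows "\<exists>f. (\<forall>n \<in> distinct_tuples N :: ('d \<Rightarrow> int) set.
                f (frame_class N (dft_frame N n))
                  = orbit (unit_group N) (pi2 N) (tuple_class N n)) \<and>
             bij_betw f (harmonic_frames N // frame_equiv N :: (complex^'d) set set set)
               (orbits (unit_group N) (unordered_tuples N :: ('d \<Rightarrow> int) set set) (pi2 N))"
proof -
  interpret residues_prime N "residue_ring (int N)"
    using assms(1) by unfold_locales
  let ?F = "\<lambda>n :: 'd \<Rightarrow> int. frame_class N (dft_frame N n)"
  let ?O = "\<lambda>n :: 'd \<Rightarrow> int. orbit (unit_group N) (pi2 N) (tuple_class N n)"
  have N0: "N > 0" using assms(1) by (rule prime_gt_0_nat)
  have "?F n = ?F n' \<longleftrightarrow> ?O n = ?O n'"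
    if n: "n \<in> distinct_tuples N" "n' \<in> distinct_tuples N" for n n'
    using eq_equiv_class_iff[OF equiv_frame_equiv dft_frame_harmonic[OF N0 n(1)]
        dft_frame_harmonic[OF N0 n(2)]]
    by (simp add: frame_class_def dft_frame_equiv_iff orbit_eq_iff n)
  then have "\<exists>f. (\<forall>n\<in>distinct_tuples N. f (?F n) = ?O n) \<and>
      bij_betw f (?F ` distinct_tuples N) (?O ` distinct_tuples N)"
    by (rule ex_bij_betw_images)
  \<comment> \<open>Every equivalence class contains a DFT frame, so the classes of DFT frames
    exhaust the quotient.\<close>
  moreover have "harmonic_frames N // frame_equiv N = ?F ` distinct_tuples N"
  proof (intro equalityI subsetI)
    fix c :: "(complex^'d) set set"
    assume "c \<in> harmonic_frames N // frame_equiv N"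
    then obtain \<Phi> where \<Phi>: "\<Phi> \<in> harmonic_frames N" "c = frame_equiv N `` {\<Phi>}"
      by (rule quotientE)
    obtain n where "n \<in> distinct_tuples N" "(\<Phi>, dft_frame N n) \<in> frame_equiv N"
      using harmonic_frame_equiv_dft[OF assms(1) \<Phi>(1)] by blast
    then show "c \<in> ?F ` distinct_tuples N"
      using equiv_class_eq[OF equiv_frame_equiv] \<Phi>(2) unfolding frame_class_def by blast
  next
    fix c assume "c \<in> ?F ` distinct_tuples N"
    then show "c \<in> harmonic_frames N // frame_equiv N"
      using dft_frame_harmonic[OF N0] by (auto simp: frame_class_def intro: quotientI)
  qed
  moreover have "orbits (unit_group N) (unordered_tuples N) (pi2 N) = ?O ` distinct_tuples N"
    by (auto simp: orbits_def unordered_tuples_def quotient_def tuple_class_def)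
  ultimately show ?thesis by simp
qed

end
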